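(* Let $\rho,\sigma:S(V)\to\mathbb{C}$ be the linear maps given by the ensembles of complete and of connected $n$-point functions, respectively. Then $\sigma=\log_\star\rho$, where the convolution logarithm is defined by its power series expansion in $\rho-\epsilon$: $$\sigma=\log_\star\rho=\sum_{k=1}^\infty\frac{(-1)^{k-1}}{k}\,(\rho-\epsilon)^{\star k}.$$
   Context: $V$ is the complex vector space of finite linear combinations of field operators $\phi(x)$, $x$ ranging over a set of labels (purely bosonic case). $S(V)=\bigoplus_{k\ge0}V^k$ is the (commutative) symmetric algebra over $V$ with unit $\mathbf 1$. The coproduct $\Delta:S(V)\to S(V)\otimes S(V)$ is the algebra homomorphism with $\Delta(\mathbf 1)=\mathbf 1\otimes\mathbf 1$, $\Delta(\phi(x))=\phi(x)\otimes\mathbf 1+\mathbf 1\otimes\phi(x)$; the counit $\epsilon:S(V)\to\mathbb C$ is given by $\epsilon(\mathbf 1)=1$ and $\epsilon(\phi(x_1)\cdots\phi(x_n))=0$ for $n>0$. The convolution product of linear maps $\alpha,\beta:S(V)\to\mathbb C$ is $\alpha\star\beta:=(\alpha\otimes\beta)\circ\Delta$; it is associative with unit $\epsilon$. $\alpha^{\star k}$ is the $k$-fold convolution product of $\alpha$ with itself, $\alpha^{\star 0}=\epsilon$. $\sigma(\phi(x_1)\cdots\phi(x_n))$ is the connected $n$-point function $G_c^{(n)}(x_1,\dots,x_n)$, with $\sigma(\mathbf 1)=0$ (and $\sigma(\phi(x))=0$). $\rho(\phi(x_1)\cdots\phi(x_n))$ is the complete $n$-point function $G^{(n)}(x_1,\dots,x_n)$,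 with $\rho(\mathbf 1)=1$. They are related, for $n\ge1$, by $$G^{(n)}(x_1,\dots,x_n)=\sum_{k=1}^n\ \sum_{I_1\cup\dots\cup I_k=\{x_1,\dots,x_n\}}\ \prod_{j=1}^kG_c(I_j),$$ the inner sum running over unordered partitions of the (distinguishable) labels into $k$ non-empty subsets. *)

theory Defs
  imports Complex_Main "HOL-Library.Poly_Mapping" "HOL-Library.Multiset"
    "HOL-Library.Product_Plus" "HOL-Library.Disjoint_Sets"
begin

text \<open>
  The field operators \<open>\<phi>(x)\<close>, with \<open>x\<close> ranging over the type \<open>'x\<close>, form a basis of \<open>V\<close>. Hence the
  monomials in them, i.e. the finite multisets of labels, form a basis of \<open>S(V)\<close>, and pairs of
  monomials form a basis of \<open>S(V) \<otimes> S(V)\<close>. The ring structure on \<^typ>\<open>'m \<Rightarrow>\<^sub>0 complex\<close> is the monoid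
  algebra one, which is the product of \<open>S(V)\<close>, respectively the componentwise product of
  \<open>S(V) \<otimes> S(V)\<close>.
\<close>

type_synonym 'x sym_alg = "'x multiset \<Rightarrow>\<^sub>0 complex"
type_synonym 'x sym_alg2 = "('x multiset \<times> 'x multiset) \<Rightarrow>\<^sub>0 complex"

definition field_op :: "'x \<Rightarrow> 'x sym_alg" where
  "field_op x = Poly_Mapping.single {#x#} 1"

definition scale :: "complex \<Rightarrow> ('m \<Rightarrow>\<^sub>0 complex) \<Rightarrow> ('m \<Rightarrow>\<^sub>0 complex)" where
  "scale c = Poly_Mapping.map ((*) c)"

abbreviation linear_functional :: "(('m \<Rightarrow>\<^sub>0 complex) \<Rightarrow> complex) \<Rightarrow> bool" where
  "linear_functional \<equiv> Vector_Spaces.linear scale (*)"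

text \<open>Linear extension of a map given on basis elements; \<open>s\<close> is the scalar action on the target.\<close>

definition lin_ext :: "(complex \<Rightarrow> 'v \<Rightarrow> 'v) \<Rightarrow> ('m \<Rightarrow> 'v) \<Rightarrow> ('m \<Rightarrow>\<^sub>0 complex) \<Rightarrow> 'v::ab_group_add" where
  "lin_ext s f a = (\<Sum>m\<in>Poly_Mapping.keys a. s (Poly_Mapping.lookup a m) (f m))"

definition tensor :: "'x sym_alg \<Rightarrow> 'x sym_alg \<Rightarrow> 'x sym_alg2" (infixl "\<otimes>" 75) where
  "a \<otimes> b = lin_ext scale (\<lambda>m. lin_ext scale (\<lambda>n. Poly_Mapping.single (m, n) 1) b) a"

definition tensor_fun ::
    "('x sym_alg \<Rightarrow> complex) \<Rightarrow> ('x sym_alg \<Rightarrow> complex) \<Rightarrow> 'x sym_alg2 \<Rightarrow> complex" where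
  "tensor_fun \<alpha> \<beta> =
     lin_ext (*) (\<lambda>(m, n). \<alpha> (Poly_Mapping.single m 1) * \<beta> (Poly_Mapping.single n 1))"

definition coproduct :: "'x sym_alg \<Rightarrow> 'x sym_alg2" where
  "coproduct = lin_ext scale (\<lambda>m. \<Prod>x\<in>#m. field_op x \<otimes> 1 + 1 \<otimes> field_op x)"

definition counit :: "'x sym_alg \<Rightarrow> complex" where
  "counit a = Poly_Mapping.lookup a {#}"

definition conv :: "('x sym_alg \<Rightarrow> complex) \<Rightarrow> ('x sym_alg \<Rightarrow> complex) \<Rightarrow> 'x sym_alg \<Rightarrow> complex"
    (infixl "\<star>" 70) where
  "\<alpha> \<star> \<beta> = tensor_fun \<alpha> \<beta> \<circ> coproduct"

primrec conv_pow :: "('x sym_alg \<Rightarrow> complex) \<Rightarrow> nat \<Rightarrow> 'x sym_alg \<Rightarrow> complex" where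
  "conv_pow \<alpha> 0 = counit"
| "conv_pow \<alpha> (Suc k) = \<alpha> \<star> conv_pow \<alpha> k"

text \<open>The series is taken pointwise on \<open>S(V)\<close>, and its index is shifted so as to start at \<open>0\<close>.\<close>

definition conv_log_term :: "('x sym_alg \<Rightarrow> complex) \<Rightarrow> 'x sym_alg \<Rightarrow> nat \<Rightarrow> complex" where
  "conv_log_term \<rho> a k =
     (-1) ^ k / of_nat (Suc k) * conv_pow (\<lambda>b. \<rho> b - counit b) (Suc k) a"

definition conv_log :: "('x sym_alg \<Rightarrow> complex) \<Rightarrow> 'x sym_alg \<Rightarrow> complex" where
  "conv_log \<rho> a = suminf (conv_log_term \<rho> a)"

text \<open>
  Positions rather than labels are partitioned, so repeated labels count as distinguishable.
  The clusters of a partition are nonempty by definition of \<^const>\<open>partition_on\<close>.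
\<close>

definition cluster_sum :: "('x list \<Rightarrow> complex) \<Rightarrow> 'x list \<Rightarrow> complex" where
  "cluster_sum Gc xs =
     (\<Sum>k = 1..length xs. \<Sum>P | partition_on {..<length xs} P \<and> card P = k.
        \<Prod>I\<in>P. Gc (nths xs I))"

subsection \<open>Characteristic properties\<close>

lemma lookup_scale [simp]: "Poly_Mapping.lookup (scale c a) m = c * Poly_Mapping.lookup a m"
  unfolding scale_def by (simp add: Poly_Mapping.map.rep_eq when_def)

lemma vector_space_scale: "vector_space (scale :: complex \<Rightarrow> ('m \<Rightarrow>\<^sub>0 complex) \<Rightarrow> _)"
  by unfold_locales (auto intro!: poly_mapping_eqI simp: lookup_add algebra_simps)

lemma vector_space_complex: "vector_space ((*) :: complex \<Rightarrow> complex \<Rightarrow> complex)"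
  by unfold_locales (auto simp: algebra_simps)

lemma scale_mult_left: "scale c (a :: 'm::comm_monoid_add \<Rightarrow>\<^sub>0 complex) * b = scale c (a * b)"
  unfolding scale_def mult_map_scale_conv_mult by (simp add: mult.assoc)

lemma scale_mult_right: "a * scale c (b :: 'm::comm_monoid_add \<Rightarrow>\<^sub>0 complex) = scale c (a * b)"
  unfolding scale_def mult_map_scale_conv_mult by (simp add: mult.left_commute)

lemma scale_single: "scale c (Poly_Mapping.single m d) = Poly_Mapping.single m (c * d)"
  unfolding scale_def by simp

lemma linear_scaleI:
  assumes "vector_space s" "\<And>a b. f (a + b) = f a + f b" "\<And>c a. f (scale c a) = s c (f a)"
  shows "Vector_Spaces.linear scale s f"
  using assms vector_space_scale
  by (simp add: Vector_Spaces.linear_iff)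

lemma linear_sum:
  assumes "Vector_Spaces.linear s t f"
  shows "f (sum g A) = (\<Sum>x\<in>A. f (g x))"
  using assms module_hom.sum unfolding linear_iff_module_hom by blast

lemma linear_scale:
  assumes "Vector_Spaces.linear s t f"
  shows "f (s c a) = t c (f a)"
  using assms module_hom.scale unfolding linear_iff_module_hom by blast

lemma linear_add:
  assumes "Vector_Spaces.linear s t f"
  shows "f (a + b) = f a + f b"
  using assms module_hom.add unfolding linear_iff_module_hom by blast

lemma lin_ext_superset:
  assumes "vector_space s" "finite A" "Poly_Mapping.keys a \<subseteq> A"
  shows "lin_ext s f a = (\<Sum>m\<in>A. s (Poly_Mapping.lookup a m) (f m))"
proof -
  interpret vector_space s by fact
  show ?thesis unfolding lin_ext_def
    by (rule sum.mono_neutral_left) (use assms in \<open>auto simp: in_keys_iff\<close>)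
qed

lemma lin_ext_linear:
  fixes f :: "'m \<Rightarrow> 'v::ab_group_add"
  assumes "vector_space s"
  shows "Vector_Spaces.linear scale s (lin_ext s f)"
proof -
  interpret T: vector_space s by fact
  show ?thesis
  proof (rule linear_scaleI[OF assms])
    fix a b :: "'m \<Rightarrow>\<^sub>0 complex"
    let ?A = "Poly_Mapping.keys a \<union> Poly_Mapping.keys b"
    have "lin_ext s f c = (\<Sum>m\<in>?A. s (Poly_Mapping.lookup c m) (f m))"
      if "Poly_Mapping.keys c \<subseteq> ?A" for c
      using that by (intro lin_ext_superset[OF assms]) auto
    from this[of a] this[of b] this[of "a + b"]
    show "lin_ext s f (a + b) = lin_ext s f a + lin_ext s f b"
      using keys_add[of a b]
      by (simp add: lookup_add T.scale_left_distrib sum.distrib)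
  next
    fix r and b :: "'m \<Rightarrow>\<^sub>0 complex"
    have "lin_ext s f (scale r b) =
        (\<Sum>m\<in>Poly_Mapping.keys b. s (Poly_Mapping.lookup (scale r b) m) (f m))"
      by (rule lin_ext_superset[OF assms]) (auto simp: in_keys_iff)
    then show "lin_ext s f (scale r b) = s r (lin_ext s f b)"
      by (simp add: lin_ext_def T.scale_sum_right)
  qed
qed

lemma lin_ext_single:
  assumes "vector_space s"
  shows "lin_ext s f (Poly_Mapping.single m c) = s c (f m)"
  using lin_ext_superset[OF assms, of "{m}" "Poly_Mapping.single m c" f] by simp

lemma lin_ext_basis: "lin_ext scale (\<lambda>m. Poly_Mapping.single m 1) a = a"
proof (rule poly_mapping_eqI)
  fix k
  have "Poly_Mapping.lookup (lin_ext scale (\<lambda>m. Poly_Mapping.single m 1) a) k =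
      (\<Sum>m\<in>Poly_Mapping.keys a. if m = k then Poly_Mapping.lookup a m else 0)"
    unfolding lin_ext_def lookup_sum by (rule sum.cong) (auto simp: lookup_single)
  then show "Poly_Mapping.lookup (lin_ext scale (\<lambda>m. Poly_Mapping.single m 1) a) k =
      Poly_Mapping.lookup a k"
    by (simp add: in_keys_iff)
qed

lemma linear_lin_ext_eq:
  assumes "Vector_Spaces.linear scale s g"
  shows "g a = lin_ext s (\<lambda>m. g (Poly_Mapping.single m 1)) a"
proof -
  have "g a = g (lin_ext scale (\<lambda>m. Poly_Mapping.single m 1) a)"
    by (simp add: lin_ext_basis)
  then show ?thesis by (simp add: lin_ext_def linear_sum[OF assms] linear_scale[OF assms])
qed

lemma monomial_eq_prod: "Poly_Mapping.single m 1 = (\<Prod>x\<in>#m. field_op x)"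
proof (induction m)
  case (add x m)
  have "Poly_Mapping.single (add_mset x m) (1::complex) = field_op x * Poly_Mapping.single m 1"
    unfolding field_op_def mult_single by simp
  then show ?case using add by simp
qed simp

lemma tensor_single:
  "Poly_Mapping.single m c \<otimes> Poly_Mapping.single n d = Poly_Mapping.single (m, n) (c * d)"
  by (simp add: tensor_def lin_ext_single[OF vector_space_scale] scale_single)

lemma linear_tensor_left: "Vector_Spaces.linear scale scale (\<lambda>a. a \<otimes> b)"
  unfolding tensor_def by (rule lin_ext_linear[OF vector_space_scale])

lemma linear_tensor_right: "Vector_Spaces.linear scale scale (\<lambda>b. a \<otimes> b)"
proof -
  interpret V: vector_space "scale :: complex \<Rightarrow> 'a sym_alg2 \<Rightarrow> _" by (rule vector_space_scale)
  have lin: "Vector_Spaces.linear scale scale (lin_ext scale (\<lambda>n. Poly_Mapping.single (m, n) 1))"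
    for m :: "'a multiset" by (rule lin_ext_linear[OF vector_space_scale])
  show ?thesis
    unfolding tensor_def lin_ext_def[of _ _ a]
    by (rule linear_scaleI[OF vector_space_scale])
      (simp_all add: linear_add[OF lin] linear_scale[OF lin] V.scale_right_distrib sum.distrib
        V.scale_sum_right mult.commute)
qed

lemma tensor_one: "1 \<otimes> 1 = 1"
  unfolding single_one[symmetric] tensor_single by (simp add: zero_prod_def)

lemma linear_tensor_fun: "linear_functional (tensor_fun \<alpha> \<beta>)"
  unfolding tensor_fun_def by (rule lin_ext_linear[OF vector_space_complex])

lemma tensor_fun_tensor:
  assumes "linear_functional \<alpha>" "linear_functional \<beta>"
  shows "tensor_fun \<alpha> \<beta> (a \<otimes> b) = \<alpha> a * \<beta> b"
proof -
  note L = linear_sum[OF linear_tensor_fun] linear_scale[OF linear_tensor_fun]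
  have "tensor_fun \<alpha> \<beta> (a \<otimes> b) = (\<Sum>m\<in>Poly_Mapping.keys a. \<Sum>n\<in>Poly_Mapping.keys b.
      Poly_Mapping.lookup a m * (Poly_Mapping.lookup b n *
        (\<alpha> (Poly_Mapping.single m 1) * \<beta> (Poly_Mapping.single n 1))))"
    unfolding tensor_def lin_ext_def[of scale]
    by (simp add: L sum_distrib_left)
      (simp add: tensor_fun_def lin_ext_single[OF vector_space_complex])
  also have "\<dots> = \<alpha> a * \<beta> b"
    unfolding linear_lin_ext_eq[OF assms(1), of a] linear_lin_ext_eq[OF assms(2), of b] lin_ext_def
      sum_product
    by (simp add: mult_ac)
  finally show ?thesis .
qed

lemma linear_coproduct: "Vector_Spaces.linear scale scale coproduct"
  unfolding coproduct_def by (rule lin_ext_linear[OF vector_space_scale])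

lemma coproduct_one: "coproduct 1 = 1 \<otimes> 1"
  unfolding coproduct_def single_one[symmetric] lin_ext_single[OF vector_space_scale]
  by (simp add: tensor_one[unfolded single_one[symmetric]] scale_single flip: single_one)

lemma coproduct_field_op: "coproduct (field_op x) = field_op x \<otimes> 1 + 1 \<otimes> field_op x"
  unfolding coproduct_def field_op_def[of x] lin_ext_single[OF vector_space_scale]
  by (simp add: vector_space.vector_space_assms(4)[OF vector_space_scale] field_op_def)

lemma coproduct_mult: "coproduct (a * b) = coproduct a * coproduct b"
proof -
  note L = linear_sum[OF linear_coproduct] linear_scale[OF linear_coproduct]
  let ?e = "\<lambda>m::'a multiset. Poly_Mapping.single m (1::complex)"
  have e: "coproduct (?e m * ?e n) = coproduct (?e m) * coproduct (?e n)" for m n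
    unfolding mult_single coproduct_def lin_ext_single[OF vector_space_scale]
    by (simp add: vector_space.vector_space_assms(4)[OF vector_space_scale])
  have "coproduct (lin_ext scale ?e a * lin_ext scale ?e b) =
      coproduct (lin_ext scale ?e a) * coproduct (lin_ext scale ?e b)"
    unfolding lin_ext_def sum_product
    by (simp add: L scale_mult_left scale_mult_right e sum_product)
  then show ?thesis by (simp add: lin_ext_basis)
qed

lemma coproduct_unique:
  assumes lin: "Vector_Spaces.linear scale scale D"
    and mult: "\<And>a b. D (a * b) = D a * D b"
    and one: "D 1 = 1 \<otimes> 1"
    and field_op: "\<And>x. D (field_op x) = field_op x \<otimes> 1 + 1 \<otimes> field_op x"
  shows "D = coproduct"
proof
  fix a
  have "D (Poly_Mapping.single m 1) = (\<Prod>x\<in>#m. field_op x \<otimes> 1 + 1 \<otimes> field_op x)" for m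
    unfolding monomial_eq_prod by (induction m) (simp_all add: one mult field_op tensor_one)
  then show "D a = coproduct a"
    by (subst linear_lin_ext_eq[OF lin]) (simp add: coproduct_def)
qed

lemma linear_counit: "linear_functional counit"
  by (rule linear_scaleI[OF vector_space_complex]) (simp_all add: counit_def lookup_add)

lemma prod_list_field_op: "prod_list (map field_op xs) = Poly_Mapping.single (mset xs) 1"
  by (simp add: monomial_eq_prod prod_mset_prod_list flip: mset_map)

lemma counit_one: "counit 1 = 1"
  by (simp add: counit_def lookup_one)

lemma counit_field_ops: "xs \<noteq> [] \<Longrightarrow> counit (prod_list (map field_op xs)) = 0"
  by (simp add: counit_def prod_list_field_op lookup_single when_def)

end

theory Submission
  imports Defs
begin

text \<open>
  The map \<open>\<partial>\<^sub>x \<alpha> = (a \<mapsto> \<alpha> (\<phi>(x) a))\<close> is a derivation of the convolution product, because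
  \<open>\<phi>(x)\<close> is primitive. Splitting a partition at the cluster containing a distinguished point turns
  the cluster expansion into \<open>\<partial>\<^sub>x \<rho> = \<partial>\<^sub>x \<sigma> \<star> \<rho>\<close>. With \<open>\<eta> = \<rho> - \<epsilon>\<close>, applying \<open>\<partial>\<^sub>x\<close> to
  the logarithm series termwise gives \<open>\<Sum>\<^sub>k (-1)\<^sup>k \<partial>\<^sub>x \<sigma> \<star> (\<epsilon> + \<eta>) \<star> \<eta>\<^sup>k\<close>, which
  telescopes to \<open>\<partial>\<^sub>x \<sigma>\<close>; on a given monomial only finitely many terms are nonzero, since
  \<open>\<eta> 1 = 0\<close>.
\<close>

section \<open>Bilinearity of convolution and its value at the unit\<close>

lemma linear_functional_eqI:
  assumes "linear_functional f" "linear_functional g"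
    and "\<And>m. f (Poly_Mapping.single m 1) = g (Poly_Mapping.single m 1)"
  shows "f = g"
proof
  show "f a = g a" for a
    unfolding linear_lin_ext_eq[OF assms(1), of a] linear_lin_ext_eq[OF assms(2), of a] assms(3) ..
qed

text \<open>Linearity comes from \<open>coproduct\<close> and from the linear extension in
  \<open>tensor_fun\<close>, which reads \<alpha> and \<beta> on monomials only.\<close>

lemma linear_conv: "linear_functional (\<alpha> \<star> \<beta>)"
  by (rule linear_scaleI[OF vector_space_complex])
    (simp_all add: conv_def linear_add[OF linear_coproduct] linear_add[OF linear_tensor_fun]
      linear_scale[OF linear_coproduct] linear_scale[OF linear_tensor_fun])

lemma conv_add_left: "(\<lambda>a. \<alpha> a + \<beta> a) \<star> \<gamma> = (\<lambda>a. (\<alpha> \<star> \<gamma>) a + (\<beta> \<star> \<gamma>) a)"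
  by (simp add: conv_def tensor_fun_def lin_ext_def fun_eq_iff case_prod_beta algebra_simps
      sum.distrib)

lemma conv_add_right: "\<gamma> \<star> (\<lambda>a. \<alpha> a + \<beta> a) = (\<lambda>a. (\<gamma> \<star> \<alpha>) a + (\<gamma> \<star> \<beta>) a)"
  by (simp add: conv_def tensor_fun_def lin_ext_def fun_eq_iff case_prod_beta algebra_simps
      sum.distrib)

lemma conv_scale_right: "\<gamma> \<star> (\<lambda>a. c * \<alpha> a) = (\<lambda>a. c * (\<gamma> \<star> \<alpha>) a)"
  by (simp add: conv_def tensor_fun_def lin_ext_def fun_eq_iff case_prod_beta algebra_simps
      sum_distrib_left)

lemma conv_zero_left: "(\<lambda>a. 0) \<star> \<alpha> = (\<lambda>a. 0)"
  by (simp add: conv_def tensor_fun_def lin_ext_def fun_eq_iff case_prod_beta)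

lemma conv_zero_right: "\<alpha> \<star> (\<lambda>a. 0) = (\<lambda>a. 0)"
  by (simp add: conv_def tensor_fun_def lin_ext_def fun_eq_iff case_prod_beta)

lemma single_empty: "Poly_Mapping.single {#} 1 = 1"
  by (simp flip: single_one)

text \<open>The unit is group-like, so its coproduct is a single basis element. This is the base
  case of the inductions over monomials below.\<close>

lemma conv_one:
  fixes \<alpha> \<beta> :: "'x sym_alg \<Rightarrow> complex"
  shows "(\<alpha> \<star> \<beta>) 1 = \<alpha> 1 * \<beta> 1"
proof -
  have "coproduct (1 :: 'x sym_alg) = Poly_Mapping.single ({#}, {#}) (1 :: complex)"
    unfolding coproduct_one tensor_one by (simp add: zero_prod_def flip: single_one)
  then show ?thesis
    by (simp add: conv_def tensor_fun_def lin_ext_single[OF vector_space_complex] single_empty)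
qed

section \<open>The derivations \<open>dfield x\<close> and the algebra laws of convolution\<close>

definition dfield :: "'x \<Rightarrow> ('x sym_alg \<Rightarrow> complex) \<Rightarrow> 'x sym_alg \<Rightarrow> complex" where
  "dfield x \<alpha> a = \<alpha> (field_op x * a)"

lemma field_op_single: "field_op x * Poly_Mapping.single m 1 = Poly_Mapping.single (add_mset x m) 1"
  by (simp add: field_op_def mult_single)

text \<open>Used as a rewrite rule in inductions over monomials: it trades an added label for a
  derivative, returning the claim to the smaller monomial for other functionals.\<close>

lemma single_add_mset:
  "\<alpha> (Poly_Mapping.single (add_mset x m) 1) = dfield x \<alpha> (Poly_Mapping.single m 1)"
  by (simp add: dfield_def field_op_single)

lemma linear_dfield: "linear_functional \<alpha> \<Longrightarrow> linear_functional (dfield x \<alpha>)"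
  by (rule linear_scaleI[OF vector_space_complex])
    (simp_all add: dfield_def scale_mult_right distrib_left linear_add linear_scale)

lemma dfield_counit: "dfield x counit = (\<lambda>a. 0)"
proof (rule linear_functional_eqI)
  show "linear_functional (\<lambda>a. 0)"
    by (rule linear_scaleI[OF vector_space_complex]) simp_all
qed (auto intro: linear_dfield linear_counit
    simp: counit_def lookup_single when_def simp flip: single_add_mset)

lemma dfield_conv: "dfield x (\<alpha> \<star> \<beta>) = (\<lambda>a. (dfield x \<alpha> \<star> \<beta>) a + (\<alpha> \<star> dfield x \<beta>) a)"
proof
  fix a
  have lin: "linear_functional (\<lambda>u. tensor_fun \<alpha> \<beta> (b * u))" for b
    by (rule linear_scaleI[OF vector_space_complex])
      (simp_all add: scale_mult_right distrib_left linear_add[OF linear_tensor_fun]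
        linear_scale[OF linear_tensor_fun])
  \<comment> \<open>Both sides are linear in \<open>u\<close>, so basis elements suffice. There the
    factor \<open>field_op x \<otimes> 1\<close> adds \<open>x\<close> to the left monomial only;
    the mirror image follows.\<close>
  have "(\<lambda>u. tensor_fun \<alpha> \<beta> (field_op x \<otimes> 1 * u)) = tensor_fun (dfield x \<alpha>) \<beta>"
    by (rule linear_functional_eqI[OF lin linear_tensor_fun])
      (simp add: tensor_fun_def field_op_def tensor_single mult_single dfield_def case_prod_beta
        lin_ext_single[OF vector_space_complex] flip: single_one split: prod.split)
  moreover have "(\<lambda>u. tensor_fun \<alpha> \<beta> (1 \<otimes> field_op x * u)) = tensor_fun \<alpha> (dfield x \<beta>)"
    by (rule linear_functional_eqI[OF lin linear_tensor_fun])
      (simp add: tensor_fun_def field_op_def tensor_single mult_single dfield_def case_prod_beta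
        lin_ext_single[OF vector_space_complex] flip: single_one split: prod.split)
  moreover have "dfield x (\<alpha> \<star> \<beta>) a = tensor_fun \<alpha> \<beta> (field_op x \<otimes> 1 * coproduct a) +
      tensor_fun \<alpha> \<beta> (1 \<otimes> field_op x * coproduct a)"
    by (simp add: dfield_def conv_def coproduct_mult coproduct_field_op distrib_right
        linear_add[OF linear_tensor_fun])
  ultimately show "dfield x (\<alpha> \<star> \<beta>) a = (dfield x \<alpha> \<star> \<beta>) a + (\<alpha> \<star> dfield x \<beta>) a"
    by (simp add: conv_def fun_eq_iff)
qed

text \<open>At the unit this is commutativity of complex multiplication. The Leibniz rule reduces a
  larger monomial to a smaller one with one functional differentiated, hence the induction with
  \<alpha> and \<beta> arbitrary. Associativity and the unit law follow the same scheme.\<close>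

lemma conv_commute: "\<alpha> \<star> \<beta> = \<beta> \<star> \<alpha>"
proof (rule linear_functional_eqI[OF linear_conv linear_conv])
  show "(\<alpha> \<star> \<beta>) (Poly_Mapping.single m 1) = (\<beta> \<star> \<alpha>) (Poly_Mapping.single m 1)" for m
    by (induction m arbitrary: \<alpha> \<beta>)
      (simp_all add: single_empty conv_one single_add_mset dfield_conv)
qed

lemma conv_assoc: "(\<alpha> \<star> \<beta>) \<star> \<gamma> = \<alpha> \<star> (\<beta> \<star> \<gamma>)"
proof (rule linear_functional_eqI[OF linear_conv linear_conv])
  show "((\<alpha> \<star> \<beta>) \<star> \<gamma>) (Poly_Mapping.single m 1) = (\<alpha> \<star> (\<beta> \<star> \<gamma>)) (Poly_Mapping.single m 1)" for m
    by (induction m arbitrary: \<alpha> \<beta> \<gamma>)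
      (simp_all add: single_empty conv_one single_add_mset dfield_conv conv_add_left conv_add_right)
qed

lemma conv_left_commute: "\<alpha> \<star> (\<beta> \<star> \<gamma>) = \<beta> \<star> (\<alpha> \<star> \<gamma>)"
  by (metis conv_assoc conv_commute)

lemma conv_counit_left:
  assumes "linear_functional \<alpha>"
  shows "counit \<star> \<alpha> = \<alpha>"
proof (rule linear_functional_eqI[OF linear_conv assms])
  show "(counit \<star> \<alpha>) (Poly_Mapping.single m 1) = \<alpha> (Poly_Mapping.single m 1)" for m
    by (induction m arbitrary: \<alpha>)
      (simp_all add: single_empty conv_one counit_one single_add_mset dfield_conv dfield_counit
        conv_zero_left)
qed

section \<open>Convolution powers and the logarithm series\<close>

lemma linear_conv_pow: "linear_functional (conv_pow \<alpha> k)"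
  by (cases k) (simp_all add: linear_counit linear_conv)

lemma dfield_conv_pow:
  "dfield x (conv_pow \<alpha> (Suc k)) = (\<lambda>a. of_nat (Suc k) * (dfield x \<alpha> \<star> conv_pow \<alpha> k) a)"
proof (induction k)
  case 0
  show ?case by (simp add: dfield_conv dfield_counit conv_zero_right)
next
  case (Suc k)
  have "dfield x (conv_pow \<alpha> (Suc (Suc k))) =
      (\<lambda>a. (dfield x \<alpha> \<star> conv_pow \<alpha> (Suc k)) a + (\<alpha> \<star> dfield x (conv_pow \<alpha> (Suc k))) a)"
    by (simp only: conv_pow.simps(2)[of \<alpha> "Suc k"] dfield_conv)
  then show ?case
    \<comment> \<open>Moving the undifferentiated \<alpha> past \<open>dfield x \<alpha>\<close>
      makes both Leibniz terms multiples of the same convolution.\<close>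
    unfolding Suc.IH conv_scale_right conv_left_commute[of \<alpha>] conv_pow.simps(2)[symmetric]
    by (simp add: algebra_simps)
qed

text \<open>Each label of \<open>m\<close> goes to one factor only, so with more factors \<eta> than
  labels some \<eta> is evaluated at the unit. The extra factor \<beta> makes the induction close:
  it absorbs differentiated copies of \<eta>.\<close>

lemma conv_pow_eq_0:
  assumes "\<eta> 1 = 0" "size m < k"
  shows "(\<beta> \<star> conv_pow \<eta> k) (Poly_Mapping.single m 1) = 0"
  using assms(2)
proof (induction m arbitrary: \<beta> k)
  case empty
  then show ?case
    by (cases k) (simp_all add: single_empty conv_one assms(1))
next
  case (add x m)
  then obtain j where k: "k = Suc j" "size m < j" by (cases k) auto
  then show ?case
    \<comment> \<open>The two Leibniz terms: either \<beta> is differentiated and the power stays,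
      or one factor of the power is, which then joins \<beta> and lowers the exponent to
      \<open>j\<close>.\<close>
    using add.IH[of "Suc j" "dfield x \<beta>"] add.IH[of j "\<beta> \<star> dfield x \<eta>"]
    by (simp add: single_add_mset dfield_conv dfield_conv_pow conv_scale_right conv_assoc
        del: conv_pow.simps)
qed

text \<open>The convolution form of recovering log f from its derivative f'/f and its value at one
  point: the derivatives settle every monomial containing a label, and the two normalisations settle
  the unit.\<close>

lemma conv_log_sums:
  assumes "linear_functional \<rho>" "linear_functional \<sigma>" "\<rho> 1 = 1" "\<sigma> 1 = 0"
    and dfield: "\<And>x. dfield x \<rho> = dfield x \<sigma> \<star> \<rho>"
  shows "conv_log_term \<rho> a sums \<sigma> a"
proof -
  define \<eta> where "\<eta> = (\<lambda>b. \<rho> b - counit b)"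
  have \<eta>1: "\<eta> 1 = 0" by (simp add: \<eta>_def assms(3) counit_one)
  have \<rho>_eq: "\<rho> = (\<lambda>b. counit b + \<eta> b)" by (simp add: \<eta>_def)
  have d\<eta>: "dfield x \<eta> = dfield x \<rho>" for x
    using dfield_counit[of x] by (simp add: \<eta>_def dfield_def fun_eq_iff)
  have mono: "conv_log_term \<rho> (Poly_Mapping.single m 1) sums \<sigma> (Poly_Mapping.single m 1)" for m
  proof (cases m)
    case empty
    have "conv_log_term \<rho> 1 = (\<lambda>k. 0)"
      using \<eta>1 by (simp add: conv_log_term_def fun_eq_iff conv_one flip: \<eta>_def)
    then show ?thesis by (simp add: empty single_empty assms(4))
  next
    case (add x n)
    let ?n = "Poly_Mapping.single n (1::complex)"
    \<comment> \<open>Writing \<rho> as \<open>counit\<close> plus \<eta> splits the term of index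
      \<open>k\<close> into two halves; \<open>h k\<close> is the one with \<eta> to the power
      \<open>k\<close>, and the other is \<open>- h (Suc k)\<close>.\<close>
    define h where "h = (\<lambda>k. (-1) ^ k * (dfield x \<sigma> \<star> conv_pow \<eta> k) ?n)"
    have "conv_log_term \<rho> (Poly_Mapping.single m 1) k = h k - h (Suc k)" for k
    proof -
      have "\<rho> \<star> conv_pow \<eta> k = (\<lambda>b. conv_pow \<eta> k b + conv_pow \<eta> (Suc k) b)"
        unfolding \<rho>_eq conv_add_left conv_counit_left[OF linear_conv_pow] by simp
      then have "dfield x \<rho> \<star> conv_pow \<eta> k =
          (\<lambda>b. (dfield x \<sigma> \<star> conv_pow \<eta> k) b + (dfield x \<sigma> \<star> conv_pow \<eta> (Suc k)) b)"
        by (simp only: dfield conv_assoc conv_add_right)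
      \<comment> \<open>The factor \<open>of_nat (Suc k)\<close> from the power rule cancels the
        denominator of the logarithm coefficient.\<close>
      moreover have "conv_log_term \<rho> (Poly_Mapping.single m 1) k =
          (-1) ^ k * (dfield x \<rho> \<star> conv_pow \<eta> k) ?n"
        unfolding conv_log_term_def \<eta>_def[symmetric] add single_add_mset dfield_conv_pow d\<eta>
        by (simp del: of_nat_Suc)
      ultimately show ?thesis
        by (simp add: h_def algebra_simps del: conv_pow.simps)
    qed
    moreover have "h \<longlonglongrightarrow> 0"
      by (rule tendsto_eventually, rule eventually_sequentiallyI[of "Suc (size n)"])
        (simp add: h_def conv_pow_eq_0[where \<eta> = \<eta>] \<eta>1)
    then have "(\<lambda>k. h k - h (Suc k)) sums (h 0 - 0)" by (rule telescope_sums')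
    moreover have "h 0 = \<sigma> (Poly_Mapping.single m 1)"
      using conv_counit_left[OF linear_dfield[OF assms(2)]]
      by (simp add: h_def add single_add_mset conv_commute[of _ counit])
    ultimately show ?thesis by (simp add: sums_def)
  qed
  \<comment> \<open>Every term of the series is linear in \<open>a\<close>, and \<open>a\<close> has
    finitely many monomials, so the sums over monomials combine into one.\<close>
  have "(\<lambda>k. \<Sum>m\<in>Poly_Mapping.keys a. Poly_Mapping.lookup a m *
      conv_log_term \<rho> (Poly_Mapping.single m 1) k) sums
      (\<Sum>m\<in>Poly_Mapping.keys a. Poly_Mapping.lookup a m * \<sigma> (Poly_Mapping.single m 1))"
    by (intro sums_sum sums_mult mono)
  moreover have "conv_log_term \<rho> a k = (\<Sum>m\<in>Poly_Mapping.keys a. Poly_Mapping.lookup a m *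
      conv_log_term \<rho> (Poly_Mapping.single m 1) k)" for k
    unfolding conv_log_term_def linear_lin_ext_eq[OF linear_conv_pow, of _ _ a] lin_ext_def
    by (simp add: sum_distrib_left mult_ac)
  moreover have "\<sigma> a = (\<Sum>m\<in>Poly_Mapping.keys a. Poly_Mapping.lookup a m *
      \<sigma> (Poly_Mapping.single m 1))"
    using linear_lin_ext_eq[OF assms(2), of a] by (simp add: lin_ext_def)
  ultimately show ?thesis by presburger
qed

section \<open>Monomials indexed by finite sets\<close>

abbreviation monomial :: "('i \<Rightarrow> 'x) \<Rightarrow> 'i set \<Rightarrow> 'x sym_alg" where
  "monomial f S \<equiv> Poly_Mapping.single (image_mset f (mset_set S)) 1"

text \<open>A product of primitive elements has a coproduct that distributes its factors in all
  ways. Indexing by a set keeps repeated labels apart, so the distributions are plain subsets. In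
  the induction, the subsets containing the new index \<open>a\<close> give the Leibniz term with
  \<alpha> differentiated, and those omitting it give the term with \<beta> differentiated.\<close>

lemma conv_monomial:
  assumes "finite S"
  shows "(\<alpha> \<star> \<beta>) (monomial f S) = (\<Sum>T\<in>Pow S. \<alpha> (monomial f T) * \<beta> (monomial f (S - T)))"
  using assms
proof (induction S arbitrary: \<alpha> \<beta> rule: finite_induct)
  case empty
  show ?case by (simp add: single_empty conv_one)
next
  case (insert a S)
  have fin: "finite T" if "T \<subseteq> S" for T using that insert.hyps(1) finite_subset by auto
  have "(\<Sum>T\<in>Pow (insert a S). \<alpha> (monomial f T) * \<beta> (monomial f (insert a S - T))) =
      (\<Sum>T\<in>Pow S. \<alpha> (monomial f T) * \<beta> (monomial f (insert a S - T))) +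
      (\<Sum>T\<in>Pow S. \<alpha> (monomial f (insert a T)) * \<beta> (monomial f (insert a S - insert a T)))"
  proof -
    have "inj_on (insert a) (Pow S)"
      using insert.hyps(2) by (intro inj_onI) (metis PowD insert_ident subsetD)
    then show ?thesis
      unfolding Pow_insert using insert.hyps
      by (subst sum.union_disjoint) (auto simp: sum.reindex)
  qed
  also have "(\<Sum>T\<in>Pow S. \<alpha> (monomial f T) * \<beta> (monomial f (insert a S - T))) =
      (\<Sum>T\<in>Pow S. \<alpha> (monomial f T) * dfield (f a) \<beta> (monomial f (S - T)))"
  proof (rule sum.cong)
    fix T assume "T \<in> Pow S"
    then have "insert a S - T = insert a (S - T)" "a \<notin> S - T" "finite (S - T)"
      using insert.hyps by auto
    then show "\<alpha> (monomial f T) * \<beta> (monomial f (insert a S - T)) =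
        \<alpha> (monomial f T) * dfield (f a) \<beta> (monomial f (S - T))"
      by (simp add: single_add_mset)
  qed simp
  also have "(\<Sum>T\<in>Pow S. \<alpha> (monomial f (insert a T)) * \<beta> (monomial f (insert a S - insert a T))) =
      (\<Sum>T\<in>Pow S. dfield (f a) \<alpha> (monomial f T) * \<beta> (monomial f (S - T)))"
  proof (rule sum.cong)
    fix T assume T: "T \<in> Pow S"
    then have "insert a S - insert a T = S - T" "a \<notin> T" "finite T"
      using insert.hyps fin by auto
    then show "\<alpha> (monomial f (insert a T)) * \<beta> (monomial f (insert a S - insert a T)) =
        dfield (f a) \<alpha> (monomial f T) * \<beta> (monomial f (S - T))"
      by (simp add: single_add_mset)
  qed simp
  finally show ?case
    using insert.hyps by (simp add: single_add_mset dfield_conv insert.IH)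
qed

section \<open>Sums over set partitions\<close>

definition partition_sum :: "('i set \<Rightarrow> 'c::comm_semiring_1) \<Rightarrow> 'i set \<Rightarrow> 'c" where
  "partition_sum w S = (\<Sum>P | partition_on S P. \<Prod>I\<in>P. w I)"

text \<open>The empty set has the empty partition, which contributes an empty product; this value
  matches \<rho> at the unit.\<close>

lemma partition_sum_empty: "partition_sum w {} = 1"
  by (simp add: partition_sum_def partition_on_empty)

lemma partition_sum_cong:
  assumes "\<And>I. I \<subseteq> S \<Longrightarrow> I \<noteq> {} \<Longrightarrow> v I = w I"
  shows "partition_sum v S = partition_sum w S"
  unfolding partition_sum_def
  by (intro sum.cong prod.cong refl assms) (auto simp: partition_on_def)

text \<open>An injection carries partitions to partitions block by block. This serves to pass
  between positions in a list and an arbitrary finite index set.\<close>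

lemma partition_sum_image:
  assumes "inj_on h A"
  shows "partition_sum w (h ` A) = partition_sum (\<lambda>I. w (h ` I)) A"
proof -
  let ?g = "inv_into A h"
  have part: "partition_on (k ` B) ((`) k ` P)" if "partition_on B P" "inj_on k B"
    for k :: "'u \<Rightarrow> 'v" and B P
  proof -
    have "{} \<notin> (`) k ` P" using partition_onD3[OF that(1)] by auto
    then show ?thesis using partition_on_inj_image[OF that] by simp
  qed
  have gh: "?g ` h ` I = I" if "I \<subseteq> A" for I
    using that assms by (simp add: inv_into_image_cancel)
  have hg: "h ` ?g ` I = I" if "I \<subseteq> h ` A" for I
    using that by (simp add: image_inv_into_cancel)
  show ?thesis
    unfolding partition_sum_def
  proof (rule sum.reindex_bij_witness[where i = "(`) ((`) h)" and j = "(`) ((`) ?g)"])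
    fix P assume P: "P \<in> {P. partition_on (h ` A) P}"
    then have sub: "I \<subseteq> h ` A" if "I \<in> P" for I using that by (auto simp: partition_on_def)
    show "(`) h ` (`) ?g ` P = P"
      unfolding image_image[of "(`) h"] using hg[OF sub] by simp
    show "(`) ?g ` P \<in> {P. partition_on A P}"
      using part[of "h ` A" P ?g] P inj_on_inv_into[of "h ` A" h A] gh[of A] by simp
    have "inj_on ((`) ?g) P"
      by (rule inj_on_inverseI[of _ "(`) h"]) (rule hg[OF sub])
    then show "(\<Prod>I\<in>(`) ?g ` P. w (h ` I)) = (\<Prod>I\<in>P. w I)"
      by (simp add: prod.reindex hg[OF sub])
  next
    fix P assume P: "P \<in> {P. partition_on A P}"
    then have sub: "I \<subseteq> A" if "I \<in> P" for I using that by (auto simp: partition_on_def)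
    show "(`) ?g ` (`) h ` P = P"
      unfolding image_image[of "(`) ?g"] using gh[OF sub] by simp
    show "(`) h ` P \<in> {P. partition_on (h ` A) P}"
      using part[of A P h] P assms by simp
  qed
qed

text \<open>A partition of \<open>insert a S\<close> amounts to the companions \<open>T\<close> of
  \<open>a\<close> in its block together with a partition of what remains of
  \<open>S\<close>.\<close>

lemma partition_sum_insert:
  assumes "finite S" "a \<notin> S"
  shows "partition_sum w (insert a S) = (\<Sum>T\<in>Pow S. w (insert a T) * partition_sum w (S - T))"
proof -
  let ?D = "Sigma (Pow S) (\<lambda>T. {Q. partition_on (S - T) Q})"
  let ?j = "\<lambda>(T, Q). insert (insert a T) Q"
  \<comment> \<open>Only the new block contains \<open>a\<close>. This makes \<open>Q\<close>
    recoverable from the enlarged partition and lets the weight of the new block factor out of the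
    product.\<close>
  have new: "insert a T \<notin> Q" if "partition_on (S - T) Q" for T Q
    using that assms(2) by (auto simp: partition_on_def)
  have part: "partition_on (insert a S) (insert (insert a T) Q)"
    if "T \<subseteq> S" "partition_on (S - T) Q" for T Q
  proof -
    have "\<Union>Q = S - T" "insert a S - insert a T = S - T"
      using that assms(2) by (auto simp: partition_on_def)
    then show ?thesis
      using that assms(2) by (subst partition_on_insert) (auto simp: disjnt_iff)
  qed
  have "bij_betw ?j ?D {P. partition_on (insert a S) P}"
  proof (rule bij_betw_imageI)
    show "inj_on ?j ?D"
    proof (rule inj_onI, clarify)
      fix T Q T' Q'
      assume *: "T \<subseteq> S" "T' \<subseteq> S" "partition_on (S - T) Q" "partition_on (S - T') Q'"
        and eq: "insert (insert a T) Q = insert (insert a T') Q'"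
      have "a \<notin> T" "a \<notin> T'" "\<forall>B\<in>Q. a \<notin> B" "\<forall>B\<in>Q'. a \<notin> B"
        using * assms(2) by (auto simp: partition_on_def)
      moreover have "insert a T \<in> insert (insert a T') Q'" using eq by (metis insertI1)
      ultimately have "insert a T = insert a T'" by auto
      then have "T = T'" using \<open>a \<notin> T\<close> \<open>a \<notin> T'\<close> by (simp add: insert_ident)
      moreover have "Q = Q'"
        using eq new[OF *(3)] new[OF *(4)] unfolding \<open>T = T'\<close> by (simp add: insert_ident)
      ultimately show "T = T' \<and> Q = Q'" by simp
    qed
    show "?j ` ?D = {P. partition_on (insert a S) P}"
    proof (intro equalityI subsetI)
      fix P assume "P \<in> {P. partition_on (insert a S) P}"
      then have P: "partition_on (insert a S) P" by simp
      then obtain B where B: "B \<in> P" "a \<in> B" by (auto simp: partition_on_def)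
      \<comment> \<open>Disjointness allows \<open>partition_on_insert\<close> to be read backwards,
        removing the block \<open>B\<close> of \<open>a\<close> from \<open>P\<close>.\<close>
      have dj: "disjnt B (\<Union>(P - {B}))"
        using partition_onD2[OF P] B(1) by (auto simp: disjnt_iff pairwise_def)
      have "partition_on (insert a S - B) (P - {B})" "B \<subseteq> insert a S"
        using partition_on_insert[OF dj, of "insert a S"] P B(1) by (simp_all add: insert_absorb)
      moreover have "insert a S - B = S - (B - {a})" "insert a (B - {a}) = B"
        using B(2) assms(2) by auto
      ultimately show "P \<in> ?j ` ?D"
        using B(1) by (intro image_eqI[of _ _ "(B - {a}, P - {B})"]) auto
    qed (auto intro: part)
  qed
  then have "partition_sum w (insert a S) = (\<Sum>x\<in>?D. \<Prod>I\<in>?j x. w I)"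
    unfolding partition_sum_def by (rule sum.reindex_bij_betw[symmetric])
  also have "\<dots> = (\<Sum>(T, Q)\<in>?D. w (insert a T) * (\<Prod>I\<in>Q. w I))"
  proof (rule sum.cong[OF refl], clarify)
    fix T Q assume "partition_on (S - T) Q"
    then show "(\<Prod>I\<in>insert (insert a T) Q. w I) = w (insert a T) * (\<Prod>I\<in>Q. w I)"
      using new finite_elements[of "S - T" Q] assms(1) by simp
  qed
  also have "\<dots> = (\<Sum>T\<in>Pow S. w (insert a T) * partition_sum w (S - T))"
    using assms(1) by (simp add: sum.Sigma[symmetric] finitely_many_partition_on partition_sum_def
        sum_distrib_left)
  finally show ?thesis .
qed

section \<open>From the cluster expansion to the differential equation\<close>

lemma cluster_sum_eq_partition_sum:
  assumes "xs \<noteq> []"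
  shows "cluster_sum Gc xs = partition_sum (\<lambda>I. Gc (nths xs I)) {..<length xs}"
proof -
  let ?A = "{P. partition_on {..<length xs} P}"
  have fin: "finite ?A" by (simp add: finitely_many_partition_on)
  have card: "card P \<in> {1..length xs}" if "P \<in> ?A" for P
  proof -
    have P: "partition_on {..<length xs} P" using that by simp
    then have "finite P" using finite_elements by blast
    moreover have "P \<noteq> {}" using P assms by (auto simp: partition_on_def)
    moreover have "finite p" "p \<noteq> {}" if "p \<in> P" for p
      using that P finite_subset[of p "{..<length xs}"] by (auto simp: partition_on_def)
    \<comment> \<open>Blocks are nonempty, so their number is at most the sum of their sizes, which
      \<open>product_partition\<close> identifies with \<open>length xs\<close>. The lower bound 1
      comes from \<open>xs\<close> being nonempty; at the empty list \<open>cluster_sum\<close> is 0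
      but \<open>partition_sum\<close> is 1.\<close>
    then have "(\<Sum>p\<in>P. 1) \<le> (\<Sum>p\<in>P. card p)"
      by (intro sum_mono) (simp add: Suc_le_eq card_gt_0_iff)
    ultimately show ?thesis
      using product_partition[OF P] \<open>\<And>p. p \<in> P \<Longrightarrow> finite p\<close>
      by (simp add: Suc_le_eq card_gt_0_iff)
  qed
  have "(\<Sum>k = 1..length xs. \<Sum>P | P \<in> ?A \<and> card P = k. \<Prod>I\<in>P. Gc (nths xs I)) =
      (\<Sum>P\<in>?A. \<Prod>I\<in>P. Gc (nths xs I))"
    by (rule sum.group[OF fin]) (use card in auto)
  then show ?thesis by (simp add: cluster_sum_def partition_sum_def)
qed

text \<open>Translates sublists into indexed monomials. The intersection is there because
  \<open>nths\<close> ignores positions beyond the end of the list.\<close>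

lemma mset_nths: "mset (nths xs I) = image_mset ((!) xs) (mset_set (I \<inter> {..<length xs}))"
proof (induction xs rule: rev_induct)
  case (snoc x xs)
  have "image_mset ((!) (xs @ [x])) (mset_set (I \<inter> {..<length xs})) =
      image_mset ((!) xs) (mset_set (I \<inter> {..<length xs}))"
    by (rule image_mset_cong) (simp add: nth_append)
  then show ?case
    by (simp add: nths_append snoc lessThan_Suc Int_insert_right)
qed simp

lemma monomial_image:
  "inj_on h I \<Longrightarrow> monomial f (h ` I) = monomial (f \<circ> h) I"
  by (simp add: image_mset_mset_set[symmetric] multiset.map_comp)

text \<open>Differentiating by \<open>x\<close> adds one index. Splitting at the block of that index
  yields a sum over subsets, which \<open>conv_monomial\<close> recognises as a convolution.\<close>

lemma dfield_of_partition_sum: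
  fixes \<rho> \<sigma> :: "'x sym_alg \<Rightarrow> complex"
  assumes "linear_functional \<rho>"
    and \<rho>: "\<And>(f :: nat \<Rightarrow> 'x) S. finite S \<Longrightarrow>
      \<rho> (monomial f S) = partition_sum (\<lambda>I. \<sigma> (monomial f I)) S"
  shows "dfield x \<rho> = dfield x \<sigma> \<star> \<rho>"
proof (rule linear_functional_eqI[OF linear_dfield[OF assms(1)] linear_conv])
  fix m :: "'x multiset"
  obtain ys where ys: "m = mset ys" using ex_mset by metis
  define n where "n = length ys"
  \<comment> \<open>The labels of \<open>m\<close> occupy the indices below \<open>n\<close>, and
    \<open>x\<close> sits at the fresh index \<open>n\<close>.\<close>
  define f where "f = (!) (ys @ [x])"
  have m: "m = image_mset f (mset_set {..<n})"
    using mset_nths[of ys UNIV]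
    by (auto simp: ys f_def n_def nths_all nth_append intro!: image_mset_cong)
  have fx: "f n = x" by (simp add: f_def n_def)
  have "dfield x \<rho> (monomial f {..<n}) = \<rho> (monomial f (insert n {..<n}))"
    by (simp add: single_add_mset fx)
  \<comment> \<open>The assumption on \<rho> is applied to the enlarged index set and again to every
    complement of \<open>T\<close>, which is why it is stated for all finite sets.\<close>
  also have "\<dots> = (\<Sum>T\<in>Pow {..<n}. \<sigma> (monomial f (insert n T)) * \<rho> (monomial f ({..<n} - T)))"
    by (subst \<rho>, simp) (subst partition_sum_insert, simp_all add: \<rho>)
  also have "\<dots> = (\<Sum>T\<in>Pow {..<n}. dfield x \<sigma> (monomial f T) * \<rho> (monomial f ({..<n} - T)))"
  proof (rule sum.cong)
    fix T assume "T \<in> Pow {..<n}"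
    then have "n \<notin> T" "finite T" using finite_subset by auto
    then show "\<sigma> (monomial f (insert n T)) * \<rho> (monomial f ({..<n} - T)) =
        dfield x \<sigma> (monomial f T) * \<rho> (monomial f ({..<n} - T))"
      by (simp add: single_add_mset fx)
  qed simp
  finally show "dfield x \<rho> (Poly_Mapping.single m 1) = (dfield x \<sigma> \<star> \<rho>) (Poly_Mapping.single m 1)"
    by (simp add: m conv_monomial)
qed

theorem corollary4:
  fixes \<rho> \<sigma> :: "'x sym_alg \<Rightarrow> complex"
    and G Gc :: "'x list \<Rightarrow> complex"
  assumes "linear_functional \<rho>" and "linear_functional \<sigma>"
    and "\<rho> 1 = 1" and "\<And>xs. xs \<noteq> [] \<Longrightarrow> \<rho> (prod_list (map field_op xs)) = G xs"
    and "\<sigma> 1 = 0" and "\<And>xs. xs \<noteq> [] \<Longrightarrow> \<sigma> (prod_list (map field_op xs)) = Gc xs"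
    and "\<And>x. \<sigma> (field_op x) = 0"
    and "\<And>xs. xs \<noteq> [] \<Longrightarrow> G xs = cluster_sum Gc xs"
  shows "\<sigma> = conv_log \<rho> \<and> (\<forall>a. conv_log_term \<rho> a sums \<sigma> a)"
proof -
  \<comment> \<open>The hypotheses speak of lists of labels; this restates the cluster expansion for
    index sets, with the empty set covered by the normalisation of \<rho>.\<close>
  have "\<rho> (monomial f S) = partition_sum (\<lambda>I. \<sigma> (monomial f I)) S"
    if fin: "finite S" for f :: "nat \<Rightarrow> 'x" and S
  proof (cases "S = {}")
    case True
    then show ?thesis by (simp add: single_empty assms(3) partition_sum_empty)
  next
    case False
    obtain h where "bij_betw h {0..<card S} S" using ex_bij_betw_nat_finite[OF fin] by auto
    then have inj: "inj_on h {..<card S}" and S: "S = h ` {..<card S}"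
      by (auto simp: bij_betw_def atLeast0LessThan)
    \<comment> \<open>The labels of \<open>S\<close> are listed along the enumeration
      \<open>h\<close>, so that position \<open>i\<close> of \<open>xs\<close> stands for the index
      \<open>h i\<close>.\<close>
    define xs where "xs = map (f \<circ> h) [0..<card S]"
    have len: "length xs = card S" by (simp add: xs_def)
    have xs: "xs \<noteq> []" using False fin by (simp add: xs_def)
    have nth: "monomial ((!) xs) I = monomial f (h ` I)" if "I \<subseteq> {..<card S}" for I
    proof -
      have "image_mset ((!) xs) (mset_set I) = image_mset (f \<circ> h) (mset_set I)"
        using that finite_subset[OF that] by (intro image_mset_cong) (auto simp: xs_def)
      then show ?thesis
        by (simp only: monomial_image[OF inj_on_subset[OF inj that]])
    qed
    have nths: "Poly_Mapping.single (mset (nths xs I)) 1 = monomial f (h ` I)"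
      if "I \<subseteq> {..<card S}" for I
      using that by (simp only: nth[symmetric] mset_nths len inf.absorb1)
    have "\<rho> (monomial f S) = \<rho> (Poly_Mapping.single (mset xs) 1)"
      using nths[of "{..<card S}"] by (simp add: S[symmetric] nths_all len)
    also have "\<dots> = partition_sum (\<lambda>I. Gc (nths xs I)) {..<card S}"
      using assms(4,8) xs by (simp add: cluster_sum_eq_partition_sum len flip: prod_list_field_op)
    also have "\<dots> = partition_sum (\<lambda>I. \<sigma> (monomial f (h ` I))) {..<card S}"
    proof (rule partition_sum_cong)
      fix I assume I: "I \<subseteq> {..<card S}" "I \<noteq> {}"
      \<comment> \<open>A nonempty block selects a nonempty sublist, where \<open>Gc\<close> is
        given by \<sigma>.\<close>
      then have "nths xs I \<noteq> []" by (auto simp: set_nths len simp flip: set_empty)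
      then show "Gc (nths xs I) = \<sigma> (monomial f (h ` I))"
        by (simp add: assms(6)[symmetric] prod_list_field_op nths[OF I(1)])
    qed
    also have "\<dots> = partition_sum (\<lambda>I. \<sigma> (monomial f I)) S"
      by (subst (2) S) (simp add: partition_sum_image[OF inj])
    finally show ?thesis .
  qed
  then have "conv_log_term \<rho> a sums \<sigma> a" for a
    using assms(1-3,5) by (intro conv_log_sums dfield_of_partition_sum)
  then show ?thesis
    by (auto simp: conv_log_def fun_eq_iff sums_iff)
qed

end
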